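(* Let $\Gamma$ be the free group of rank $r\ge1$ with boundary $(\Omega,\nu)$. For all integers $0\le i\le n$ and every $p\in[1,\infty]$, the operator $T_{n,i}$ on $L^p(\Omega\times\Omega,\nu\otimes\nu)$ given by $$T_{n,i}F(\omega,\omega')=\sum_{\gamma\in S_n}\mathbf 1_{A_i(\gamma)}(\omega)\,\mathbf 1_{A_{n-i}(\gamma^{-1})}(\omega')\,P(\gamma,\omega)^{1/2}P(\gamma^{-1},\omega')^{1/2}F(\gamma^{-1}\omega,\gamma\omega')$$ satisfies $$\|T_{n,i}\|_{L^p(\Omega\times\Omega,\nu\otimes\nu)\to L^p(\Omega\times\Omega,\nu\otimes\nu)}\le 1.$$
   Context: $\Gamma$ is the free group on $a_1,\dots,a_r$, $|\gamma|$ is word length with respect to $\{a_j^{\pm1}\}_{j=1}^r$, $S_n=\{\gamma\in\Gamma:|\gamma|=n\}$, and $q:=2r-1$. An element $\gamma\in S_n$ is written as a reduced word $\gamma=\gamma_1\cdots\gamma_n$ with letters $\gamma_k\in\{a_j^{\pm1}\}_{j=1}^r$. The boundary $\Omega$ is the set of infinite reduced words $\omega=\omega_1\omega_2\omega_3\cdots$ with letters in $\{a_j^{\pm1}\}_{j=1}^r$ (reduced: $\omega_{k+1}\ne\omega_k^{-1}$ for all $k$); $\Gamma$ acts on $\Omega$ by left multiplication (concatenate and reduce). For $g\in\Gamma$ put $\Omega_g:=\{\omega\in\Omega:\omega_1\cdots\omega_{|g|}=g\}$ (so $\Omega_e=\Omega$ for the neutral element $e$); these sets form a basis of a compact topology on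 $\Omega$. $\nu$ is the unique Borel probability measure on $\Omega$ with $\nu(\Omega_g)=\frac{1}{(q+1)q^{|g|-1}}$ for all $g\ne e$; it is quasi-invariant under $\Gamma$. $P(\gamma,\omega)=\frac{d\gamma_*\nu}{d\nu}(\omega)$ is the Radon–Nikodym derivative, where $\gamma_*\nu(E)=\nu(\gamma^{-1}E)$. For $\gamma\in S_n$ and $0\le i\le n-1$, $A_i(\gamma):=\{\omega\in\Omega:\omega_1\cdots\omega_i=\gamma_1\cdots\gamma_i\text{ and }\omega_{i+1}\ne\gamma_{i+1}\}$, and $A_n(\gamma):=\Omega_\gamma$. (With $\pi(\gamma)\phi(\omega)=P(\gamma,\omega)^{1/2}\phi(\gamma^{-1}\omega)$ and $\pi_i(\gamma)=\mathbf 1_{A_i(\gamma)}\pi(\gamma)$, the operator is $T_{n,i}=\sum_{\gamma\in S_n}\pi_i(\gamma)\otimes\pi_{n-i}(\gamma^{-1})$.) *)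

theory Defs
  imports "HOL-Probability.Probability" "HOL-Library.Stream" "HOL-Algebra.Group"
begin

text \<open>The letter \<open>(j, True)\<close> is the generator \<open>a\<^sub>j\<close> and \<open>(j, False)\<close> is its inverse.\<close>

type_synonym letter = "nat \<times> bool"

definition letters :: "nat \<Rightarrow> letter set" where
  "letters r = {1..r} \<times> UNIV"

definition letter_inv :: "letter \<Rightarrow> letter" where
  "letter_inv x = (fst x, \<not> snd x)"

definition reduced_word :: "letter list \<Rightarrow> bool" where
  "reduced_word w \<longleftrightarrow> (\<forall>k. Suc k < length w \<longrightarrow> w ! Suc k \<noteq> letter_inv (w ! k))"

definition cons_red :: "letter \<Rightarrow> letter list \<Rightarrow> letter list" where
  "cons_red x w = (case w of [] \<Rightarrow> [x] | y # w' \<Rightarrow> if y = letter_inv x then w' else x # w)"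

definition free_group :: "nat \<Rightarrow> letter list monoid" where
  "free_group r =
     \<lparr>carrier = {w. set w \<subseteq> letters r \<and> reduced_word w}, mult = foldr cons_red, one = []\<rparr>"

text \<open>The word length of a group element is the \<^const>\<open>length\<close> of its reduced word.\<close>

definition sphere_fg :: "nat \<Rightarrow> nat \<Rightarrow> letter list set" where
  "sphere_fg r n = {g \<in> carrier (free_group r). length g = n}"

text \<open>Streams are indexed from 0, so the letter \<open>\<omega>\<^sub>k\<close> of the mathematical text is \<open>\<omega> !! (k - 1)\<close>.\<close>

definition boundary :: "nat \<Rightarrow> letter stream set" where
  "boundary r = {\<omega>. \<forall>k. \<omega> !! k \<in> letters r \<and> \<omega> !! Suc k \<noteq> letter_inv (\<omega> !! k)}"

definition scons_red :: "letter \<Rightarrow> letter stream \<Rightarrow> letter stream" where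
  "scons_red x \<omega> = (if shd \<omega> = letter_inv x then stl \<omega> else x ## \<omega>)"

definition bd_act :: "letter list \<Rightarrow> letter stream \<Rightarrow> letter stream" where
  "bd_act g = foldr scons_red g"

definition cyl :: "nat \<Rightarrow> letter list \<Rightarrow> letter stream set" where
  "cyl r g = {\<omega> \<in> boundary r. stake (length g) \<omega> = g}"

definition bd_topology :: "nat \<Rightarrow> letter stream topology" where
  "bd_topology r = topology_generated_by (cyl r ` carrier (free_group r))"

definition bd_borel :: "nat \<Rightarrow> letter stream measure" where
  "bd_borel r = sigma (boundary r) {U. openin (bd_topology r) U}"

text \<open>Such a measure exists and is unique for \<open>r \<ge> 1\<close>. Here \<open>q = 2 * r - 1\<close>.\<close>

definition is_bd_measure :: "nat \<Rightarrow> letter stream measure \<Rightarrow> bool" where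
  "is_bd_measure r \<nu> \<longleftrightarrow>
     prob_space \<nu> \<and> sets \<nu> = sets (bd_borel r) \<and>
     (\<forall>g \<in> carrier (free_group r). g \<noteq> \<one>\<^bsub>free_group r\<^esub> \<longrightarrow>
        measure \<nu> (cyl r g)
          = 1 / ((real (2 * r - 1) + 1) * real (2 * r - 1) ^ (length g - 1)))"

text \<open>The push-forward satisfies \<open>g\<^sub>*\<nu>(E) = \<nu>({\<omega>. g \<omega> \<in> E}) = \<nu>(g\<^sup>-\<^sup>1 E)\<close>. The derivative is an
  arbitrary but fixed version; another choice changes \<open>T_op\<close> below only on null sets.\<close>

definition bd_P :: "letter stream measure \<Rightarrow> letter list \<Rightarrow> letter stream \<Rightarrow> real" where
  "bd_P \<nu> g \<omega> = enn2real (RN_deriv \<nu> (distr \<nu> \<nu> (bd_act g)) \<omega>)"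

text \<open>Only \<open>i \<le> length g\<close> is meaningful; the last branch is the case \<open>i = length g\<close>.\<close>

definition bd_A :: "nat \<Rightarrow> nat \<Rightarrow> letter list \<Rightarrow> letter stream set" where
  "bd_A r i g =
     (if i < length g
      then {\<omega> \<in> boundary r. stake i \<omega> = take i g \<and> \<omega> !! i \<noteq> g ! i}
      else cyl r g)"

definition T_op ::
    "nat \<Rightarrow> letter stream measure \<Rightarrow> nat \<Rightarrow> nat \<Rightarrow>
     (letter stream \<times> letter stream \<Rightarrow> complex) \<Rightarrow> letter stream \<times> letter stream \<Rightarrow> complex" where
  "T_op r \<nu> n i F = (\<lambda>(\<omega>, \<omega>').
     \<Sum>g \<in> sphere_fg r n.
       indicator (bd_A r i g) \<omega> * indicator (bd_A r (n - i) (inv\<^bsub>free_group r\<^esub> g)) \<omega>'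
       * of_real (sqrt (bd_P \<nu> g \<omega>)) * of_real (sqrt (bd_P \<nu> (inv\<^bsub>free_group r\<^esub> g) \<omega>'))
       * F (bd_act (inv\<^bsub>free_group r\<^esub> g) \<omega>, bd_act g \<omega>'))"

definition Lp_norm :: "ennreal \<Rightarrow> 'a measure \<Rightarrow> ('a \<Rightarrow> complex) \<Rightarrow> ennreal" where
  "Lp_norm p M f =
     (if p = \<infinity> then esssup M (\<lambda>x. ennreal (norm (f x)))
      else let I = (\<integral>\<^sup>+ x. ennreal (norm (f x) powr enn2real p) \<partial>M)
           in if I = \<infinity> then \<infinity> else ennreal (enn2real I powr (1 / enn2real p)))"

definition Lp_set :: "ennreal \<Rightarrow> 'a measure \<Rightarrow> ('a \<Rightarrow> complex) set" where
  "Lp_set p M = {f \<in> borel_measurable M. Lp_norm p M f < \<infinity>}"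

text \<open>Elements of \<open>L\<^sup>p\<close> are represented by functions; the second conjunct says that
  \<open>T\<close> descends to classes modulo equality almost everywhere.\<close>

definition Lp_operator ::
    "ennreal \<Rightarrow> 'a measure \<Rightarrow> (('a \<Rightarrow> complex) \<Rightarrow> 'a \<Rightarrow> complex) \<Rightarrow> bool" where
  "Lp_operator p M T \<longleftrightarrow>
     (\<forall>F \<in> Lp_set p M. T F \<in> Lp_set p M) \<and>
     (\<forall>F \<in> Lp_set p M. \<forall>G \<in> Lp_set p M. (AE x in M. F x = G x) \<longrightarrow> (AE x in M. T F x = T G x)) \<and>
     (\<forall>F \<in> Lp_set p M. \<forall>G \<in> Lp_set p M. AE x in M. T (\<lambda>y. F y + G y) x = T F x + T G x) \<and>
     (\<forall>F \<in> Lp_set p M. \<forall>c. AE x in M. T (\<lambda>y. c * F y) x = c * T F x)"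

definition Lp_opnorm ::
    "ennreal \<Rightarrow> 'a measure \<Rightarrow> (('a \<Rightarrow> complex) \<Rightarrow> 'a \<Rightarrow> complex) \<Rightarrow> ennreal" where
  "Lp_opnorm p M T = (SUP F \<in> {F \<in> Lp_set p M. Lp_norm p M F \<le> 1}. Lp_norm p M (T F))"

lemma letter_inv_letter_inv [simp]: "letter_inv (letter_inv x) = x"
  by (simp add: letter_inv_def)

lemma letter_inv_neq [simp]: "letter_inv x \<noteq> x" "x \<noteq> letter_inv x"
  by (auto simp: letter_inv_def prod_eq_iff)

lemma letter_inv_in_letters [simp]: "letter_inv x \<in> letters r \<longleftrightarrow> x \<in> letters r"
  by (cases x) (auto simp: letter_inv_def letters_def)

lemma finite_letters [simp]: "finite (letters r)"
  by (simp add: letters_def)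

lemma reduced_Nil [simp]: "reduced_word []"
  by (simp add: reduced_word_def)

lemma reduced_single [simp]: "reduced_word [x]"
  by (simp add: reduced_word_def)

lemma reduced_Cons_Cons [simp]:
  "reduced_word (x # y # w) \<longleftrightarrow> y \<noteq> letter_inv x \<and> reduced_word (y # w)"
proof
  assume L: "reduced_word (x # y # w)"
  have "y \<noteq> letter_inv x" using L unfolding reduced_word_def by (auto dest: spec[of _ 0])
  moreover have "reduced_word (y # w)" unfolding reduced_word_def
  proof (intro allI impI)
    fix k assume "Suc k < length (y # w)"
    with L[unfolded reduced_word_def, rule_format, of "Suc k"]
    show "(y # w) ! Suc k \<noteq> letter_inv ((y # w) ! k)" by simp
  qed
  ultimately show "y \<noteq> letter_inv x \<and> reduced_word (y # w)" ..
next
  assume R: "y \<noteq> letter_inv x \<and> reduced_word (y # w)"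
  show "reduced_word (x # y # w)" unfolding reduced_word_def
  proof (intro allI impI)
    fix k assume "Suc k < length (x # y # w)"
    then show "(x # y # w) ! Suc k \<noteq> letter_inv ((x # y # w) ! k)"
      using R by (cases k) (auto simp: reduced_word_def)
  qed
qed

lemma reduced_ConsD: "reduced_word (x # w) \<Longrightarrow> reduced_word w"
  by (cases w) auto

lemma reduced_cons_red: "reduced_word w \<Longrightarrow> reduced_word (cons_red x w)"
  by (cases w) (auto simp: cons_red_def dest: reduced_ConsD)

lemma set_cons_red: "x \<in> letters r \<Longrightarrow> set w \<subseteq> letters r \<Longrightarrow> set (cons_red x w) \<subseteq> letters r"
  by (cases w) (auto simp: cons_red_def)

lemma cons_red_reduced: "reduced_word (x # w) \<Longrightarrow> cons_red x w = x # w"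
  by (cases w) (auto simp: cons_red_def)

lemma cons_red_inv: "reduced_word w \<Longrightarrow> cons_red x (cons_red (letter_inv x) w) = w"
  by (cases w) (auto simp: cons_red_def cons_red_reduced split: list.splits)

lemma reduced_foldr: "reduced_word w \<Longrightarrow> reduced_word (foldr cons_red u w)"
  by (induction u) (auto intro: reduced_cons_red)

lemma set_foldr:
  "set u \<subseteq> letters r \<Longrightarrow> set w \<subseteq> letters r \<Longrightarrow> set (foldr cons_red u w) \<subseteq> letters r"
  by (induction u) (auto dest!: set_cons_red)

lemma foldr_cons_red:
  assumes "reduced_word w"
  shows "foldr cons_red (cons_red x v) w = cons_red x (foldr cons_red v w)"
proof (cases v)
  case (Cons y v')
  have "cons_red x (cons_red (letter_inv x) (foldr cons_red v' w)) = foldr cons_red v' w"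
    by (intro cons_red_inv reduced_foldr assms)
  then show ?thesis
    using Cons by (cases "y = letter_inv x") (simp_all add: cons_red_def[of x "_ # v'"])
qed (simp add: cons_red_def)

lemma foldr_assoc:
  "reduced_word w \<Longrightarrow> foldr cons_red (foldr cons_red u v) w = foldr cons_red u (foldr cons_red v w)"
  by (induction u) (auto simp: foldr_cons_red)

lemma foldr_cons_red_Nil: "reduced_word u \<Longrightarrow> foldr cons_red u [] = u"
proof (induction u)
  case (Cons x u)
  then show ?case using reduced_ConsD[of x u] by (simp add: cons_red_reduced)
qed simp

lemma reduced_rev_inv: "reduced_word w \<Longrightarrow> reduced_word (rev (map letter_inv w))"
  unfolding reduced_word_def
proof (intro allI impI)
  fix k
  assume w: "\<forall>k. Suc k < length w \<longrightarrow> w ! Suc k \<noteq> letter_inv (w ! k)"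
    and k: "Suc k < length (rev (map letter_inv w))"
  define m where "m = length w - Suc (Suc k)"
  have m: "Suc m < length w" "length w - Suc k = Suc m"
    using k by (auto simp: m_def)
  have "rev (map letter_inv w) ! Suc k = letter_inv (w ! m)"
    "rev (map letter_inv w) ! k = letter_inv (w ! Suc m)"
    using k m by (simp_all add: rev_nth m_def)
  then show "rev (map letter_inv w) ! Suc k \<noteq> letter_inv (rev (map letter_inv w) ! k)"
    using w m(1) by (metis letter_inv_letter_inv)
qed

lemma foldr_rev_inv: "reduced_word w \<Longrightarrow> foldr cons_red (rev (map letter_inv u)) (foldr cons_red u w) = w"
proof (induction u)
  case (Cons x u)
  have "cons_red (letter_inv x) (cons_red x (foldr cons_red u w)) = foldr cons_red u w"
    using cons_red_inv[of "foldr cons_red u w" "letter_inv x"] reduced_foldr Cons.prems by simp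
  then show ?case using Cons by simp
qed simp

lemma rev_inv_mult:
  assumes "reduced_word u" shows "foldr cons_red (rev (map letter_inv u)) u = []"
  using foldr_rev_inv[of "[]" u] assms by (simp add: foldr_cons_red_Nil)

lemma rev_inv_carrier:
  "u \<in> carrier (free_group r) \<Longrightarrow> rev (map letter_inv u) \<in> carrier (free_group r)"
  by (auto simp: free_group_def reduced_rev_inv)

lemma group_free_group: "Group.group (free_group r)"
proof (rule groupI)
  fix u assume "u \<in> carrier (free_group r)"
  then show "\<exists>y\<in>carrier (free_group r). y \<otimes>\<^bsub>free_group r\<^esub> u = \<one>\<^bsub>free_group r\<^esub>"
    using rev_inv_mult[of u]
    by (intro bexI[OF _ rev_inv_carrier]) (auto simp: free_group_def)
qed (use set_foldr in \<open>auto simp: free_group_def reduced_foldr foldr_assoc\<close>)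

lemma inv_free_group:
  assumes "u \<in> carrier (free_group r)"
  shows "inv\<^bsub>free_group r\<^esub> u = rev (map letter_inv u)"
proof (rule group.inv_equality[OF group_free_group])
  show "rev (map letter_inv u) \<otimes>\<^bsub>free_group r\<^esub> u = \<one>\<^bsub>free_group r\<^esub>"
    using rev_inv_mult[of u] assms by (simp add: free_group_def)
qed (use assms rev_inv_carrier in auto)

lemma finite_sphere_fg: "finite (sphere_fg r n)"
  by (rule finite_subset[OF _ finite_lists_length_eq[OF finite_letters[of r], of n]])
     (auto simp: sphere_fg_def free_group_def)

lemma topspace_bd_topology: "topspace (bd_topology r) = boundary r"
proof -
  have "cyl r [] = boundary r" "[] \<in> carrier (free_group r)" "\<And>g. cyl r g \<subseteq> boundary r"
    by (auto simp: cyl_def free_group_def)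
  then show ?thesis
    unfolding bd_topology_def topology_generated_by_topspace by blast
qed

end

(*
On A_i(g), for g of length n, the Radon-Nikodym derivative P(g, .) is the constant q^(2i-n), so on
the product D_g of A_i(g) and A_(n-i)(g^-1) the two square roots multiply to 1. The pair (w, w')
determines the only g with (w, w') in D_g: its first i letters are those of w, and the first n-i
letters of g^-1 are those of w'. Hence T F = F o (g^-1 x g) on D_g and T F = 0 off the disjoint
sets D_g. The map g^-1 x g sends D_g into the product of A_(n-i)(g^-1) and A_i(g), where the density
of the push-forward is again 1, and these images are disjoint for distinct g as well. So T composes
F with a measure-preserving map on part of the space and cuts off the rest.
*)

theory Submission
  imports Defs
begin

section \<open>Reduced words, boundary points and the action of letters\<close>

lemma mem_carrier_free_group:
  "w \<in> carrier (free_group r) \<longleftrightarrow> set w \<subseteq> letters r \<and> reduced_word w"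
  by (simp add: free_group_def)

lemma one_free_group: "\<one>\<^bsub>free_group r\<^esub> = []"
  by (simp add: free_group_def)

lemma Cons_carrier_free_group:
  "x # g \<in> carrier (free_group r) \<longleftrightarrow>
     x \<in> letters r \<and> g \<in> carrier (free_group r) \<and> (g \<noteq> [] \<longrightarrow> hd g \<noteq> letter_inv x)"
  by (cases g) (auto simp: mem_carrier_free_group)

lemma length_inv_free_group:
  "g \<in> carrier (free_group r) \<Longrightarrow> length (inv\<^bsub>free_group r\<^esub> g) = length g"
  by (simp add: inv_free_group)

lemma boundary_iff:
  "\<omega> \<in> boundary r \<longleftrightarrow>
     shd \<omega> \<in> letters r \<and> shd (stl \<omega>) \<noteq> letter_inv (shd \<omega>) \<and> stl \<omega> \<in> boundary r"
proof
  assume R: "shd \<omega> \<in> letters r \<and> shd (stl \<omega>) \<noteq> letter_inv (shd \<omega>) \<and> stl \<omega> \<in> boundary r"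
  show "\<omega> \<in> boundary r"
    unfolding boundary_def
  proof (intro CollectI allI)
    fix k show "\<omega> !! k \<in> letters r \<and> \<omega> !! Suc k \<noteq> letter_inv (\<omega> !! k)"
      using R by (cases k) (auto simp: boundary_def)
  qed
next
  assume L: "\<omega> \<in> boundary r"
  then have "\<omega> !! k \<in> letters r \<and> \<omega> !! Suc k \<noteq> letter_inv (\<omega> !! k)" for k
    by (simp add: boundary_def)
  from this[of 0] this[of "Suc _"]
  show "shd \<omega> \<in> letters r \<and> shd (stl \<omega>) \<noteq> letter_inv (shd \<omega>) \<and> stl \<omega> \<in> boundary r"
    by (auto simp: boundary_def)
qed

lemma stl_boundary: "\<omega> \<in> boundary r \<Longrightarrow> stl \<omega> \<in> boundary r"
  by (subst (asm) boundary_iff) simp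

lemma shd_boundary: "\<omega> \<in> boundary r \<Longrightarrow> shd \<omega> \<in> letters r"
  by (subst (asm) boundary_iff) simp

lemma shd_stl_boundary: "\<omega> \<in> boundary r \<Longrightarrow> shd (stl \<omega>) \<noteq> letter_inv (shd \<omega>)"
  by (subst (asm) boundary_iff) simp

lemma sdrop_boundary: "\<omega> \<in> boundary r \<Longrightarrow> sdrop k \<omega> \<in> boundary r"
  by (induction k arbitrary: \<omega>) (auto simp: stl_boundary)

lemma Cons_boundary:
  "x ## \<omega> \<in> boundary r \<longleftrightarrow> x \<in> letters r \<and> shd \<omega> \<noteq> letter_inv x \<and> \<omega> \<in> boundary r"
  by (subst boundary_iff) simp

lemma stake_carrier: "\<omega> \<in> boundary r \<Longrightarrow> stake k \<omega> \<in> carrier (free_group r)"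
proof (induction k arbitrary: \<omega>)
  case (Suc k)
  have "stake k (stl \<omega>) \<in> carrier (free_group r)"
    using Suc stl_boundary by blast
  then show ?case
    using Suc.prems shd_boundary[OF Suc.prems] shd_stl_boundary[OF Suc.prems]
    by (cases k) (auto simp: Cons_carrier_free_group)
qed (simp add: mem_carrier_free_group)

lemma scons_red_boundary: "x \<in> letters r \<Longrightarrow> \<omega> \<in> boundary r \<Longrightarrow> scons_red x \<omega> \<in> boundary r"
  by (auto simp: scons_red_def stl_boundary Cons_boundary)

lemma bd_act_Nil: "bd_act [] \<omega> = \<omega>"
  by (simp add: bd_act_def)

lemma bd_act_Cons: "bd_act (x # g) \<omega> = scons_red x (bd_act g \<omega>)"
  by (simp add: bd_act_def)

lemma bd_act_append: "bd_act (u @ v) \<omega> = bd_act u (bd_act v \<omega>)"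
  by (simp add: bd_act_def)

text \<open>If \<open>x\<close> cancels the first letter of \<open>\<omega>\<close>, then
  reducedness of \<open>\<omega>\<close> keeps \<open>letter_inv x\<close> from cancelling the
  letter that has moved to the front. Otherwise the prepended \<open>x\<close> is simply removed
  again.\<close>

lemma scons_red_inverse:
  assumes "\<omega> \<in> boundary r"
  shows "scons_red (letter_inv x) (scons_red x \<omega>) = \<omega>"
proof -
  obtain y s where "\<omega> = y ## s"
    by (metis stream.collapse)
  then show ?thesis
    using shd_stl_boundary[OF assms] by (auto simp: scons_red_def)
qed

lemma cyl_Nil: "cyl r [] = boundary r"
  by (auto simp: cyl_def)

lemma mem_cyl_Cons:
  "\<omega> \<in> cyl r (x # g) \<longleftrightarrow> \<omega> \<in> boundary r \<and> shd \<omega> = x \<and> stl \<omega> \<in> cyl r g"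
  by (auto simp: cyl_def stl_boundary)

text \<open>The product can start with a letter other than \<open>x\<close> only if \<open>x\<close>
  was cancelled, so \<open>\<omega>\<close> must start with \<open>letter_inv x\<close>. If it is to
  start with \<open>x\<close> there was no cancellation, because the letter left in front by a
  cancellation is never \<open>x\<close>. For \<open>g = [x]\<close> the formula would fail:
  \<open>tl g\<close> would give the whole boundary, although points starting with
  \<open>letter_inv x\<close> must be excluded.\<close>

lemma scons_red_mem_cyl:
  assumes "x \<in> letters r" "g \<in> carrier (free_group r)" "length g \<ge> 2" "\<omega> \<in> boundary r"
  shows "scons_red x \<omega> \<in> cyl r g \<longleftrightarrow> \<omega> \<in> cyl r (if hd g = x then tl g else letter_inv x # g)"
proof -
  \<comment> \<open>\<open>remdups_adj.cases\<close> splits lists into empty ones, singletons and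
    those with at least two entries.\<close>
  obtain y z g' where g: "g = y # z # g'"
    using assms(3) by (cases g rule: remdups_adj.cases) auto
  show ?thesis
    using assms shd_stl_boundary[OF assms(4)] g
    by (cases "shd \<omega> = letter_inv x")
       (auto simp: scons_red_def mem_cyl_Cons Cons_carrier_free_group Cons_boundary stl_boundary)
qed

section \<open>Cylinders as generators of the Borel sets\<close>

lemma cyl_Int_cases:
  assumes "length g \<le> length h"
  shows "cyl r g \<inter> cyl r h = (if take (length g) h = g then cyl r h else {})"
proof -
  have "stake (length g) \<omega> = take (length g) h" if "stake (length h) \<omega> = h" for \<omega> :: "letter stream"
    using assms take_stake[of "length g" "length h" \<omega>] that by (simp add: min_absorb1)
  then show ?thesis
    by (auto simp: cyl_def)
qed

lemma countable_carrier_free_group: "countable (carrier (free_group r))"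
  by (rule countableI_type)

text \<open>For a word of length at least 2, the preimage of its cylinder under a generator is again the
  cylinder of a nonempty word, whose measure is prescribed.\<close>

definition long_cyls :: "nat \<Rightarrow> letter stream set set" where
  "long_cyls r = insert {} (cyl r ` {g \<in> carrier (free_group r). length g \<ge> 2})"

lemma Int_stable_long_cyls: "Int_stable (long_cyls r)"
proof (rule Int_stableI)
  fix A B assume AB: "A \<in> long_cyls r" "B \<in> long_cyls r"
  show "A \<inter> B \<in> long_cyls r"
  proof (cases "A = {} \<or> B = {}")
    case False
    then obtain g h where "A = cyl r g" "B = cyl r h" "cyl r g \<in> long_cyls r" "cyl r h \<in> long_cyls r"
      using AB by (auto simp: long_cyls_def)
    then show ?thesis
      using cyl_Int_cases[of g h r] cyl_Int_cases[of h g r]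
      by (cases "length g \<le> length h") (auto simp: Int_commute long_cyls_def)
  qed (auto simp: long_cyls_def)
qed

lemma cyl_subset_boundary: "cyl r g \<subseteq> boundary r"
  by (auto simp: cyl_def)

lemma long_cyls_Pow: "long_cyls r \<subseteq> Pow (boundary r)"
  using cyl_subset_boundary by (auto simp: long_cyls_def)

text \<open>Each point of a cylinder also lies in the cylinder of its prefix that is two letters
  longer. This brings the short cylinders, and the whole space as \<open>cyl r []\<close>, into the
  sigma-algebra of \<open>long_cyls\<close>.\<close>

lemma cyl_eq_UN_long_cyls:
  "cyl r g = \<Union> (cyl r ` {h \<in> carrier (free_group r). length h \<ge> 2 \<and> cyl r h \<subseteq> cyl r g})"
proof
  show "cyl r g \<subseteq> \<Union> (cyl r ` {h \<in> carrier (free_group r). length h \<ge> 2 \<and> cyl r h \<subseteq> cyl r g})"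
  proof
    fix \<omega> assume \<omega>: "\<omega> \<in> cyl r g"
    define h where "h = stake (length g + 2) \<omega>"
    have "h \<in> carrier (free_group r)" "length h \<ge> 2" "\<omega> \<in> cyl r h"
      using \<omega> stake_carrier[of \<omega>] by (auto simp: h_def cyl_def simp del: stake.simps)
    moreover have "take (length g) h = g" "length g \<le> length h"
      using \<omega> by (auto simp: h_def cyl_def take_stake min_def simp del: stake.simps)
    ultimately show "\<omega> \<in> \<Union> (cyl r ` {h \<in> carrier (free_group r). length h \<ge> 2 \<and> cyl r h \<subseteq> cyl r g})"
      using cyl_Int_cases[of g h r] by auto
  qed
qed auto

text \<open>The cylinders are a basis and not only a subbasis, since two cylinders with a common
  point are nested.\<close>

lemma openin_bd_topology_cyl:
  assumes "openin (bd_topology r) U" "\<omega> \<in> U"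
  shows "\<exists>g\<in>carrier (free_group r). \<omega> \<in> cyl r g \<and> cyl r g \<subseteq> U"
proof -
  have "generate_topology_on (cyl r ` carrier (free_group r)) U"
    using assms(1) unfolding bd_topology_def by (rule openin_topology_generated_by)
  then show ?thesis
    using assms(2)
  proof (induction arbitrary: \<omega>)
    case (Int a b)
    obtain g h where g: "g \<in> carrier (free_group r)" "\<omega> \<in> cyl r g" "cyl r g \<subseteq> a"
      and h: "h \<in> carrier (free_group r)" "\<omega> \<in> cyl r h" "cyl r h \<subseteq> b"
      using Int by (meson IntD1 IntD2)
    then have "cyl r h \<subseteq> cyl r g \<or> cyl r g \<subseteq> cyl r h"
      using cyl_Int_cases[of g h r] cyl_Int_cases[of h g r]
      by (cases "length g \<le> length h") (auto split: if_splits)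
    then show ?case
      using g h by (meson Int_greatest order_trans)
  next
    case (UN K)
    then show ?case by (meson UnionE Union_upper order_trans)
  qed auto
qed

text \<open>There are only countably many words, so an open set is a countable union of cylinders,
  and each of these is a countable union of long ones.\<close>

lemma sets_bd_borel: "sets (bd_borel r) = sigma_sets (boundary r) (long_cyls r)"
proof -
  have sub: "{U. openin (bd_topology r) U} \<subseteq> Pow (boundary r)"
    using openin_subset[of "bd_topology r"] by (auto simp: topspace_bd_topology)
  have cyl: "cyl r g \<in> sigma_sets (boundary r) (long_cyls r)" for g
    by (subst cyl_eq_UN_long_cyls)
       (auto intro!: sigma_sets_UNION countable_subset[OF _ countable_carrier_free_group]
             simp: long_cyls_def)
  have "sigma_sets (boundary r) {U. openin (bd_topology r) U} = sigma_sets (boundary r) (long_cyls r)"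
  proof (rule sigma_sets_eqI)
    fix U assume "U \<in> {U. openin (bd_topology r) U}"
    then have U: "U = \<Union> (cyl r ` {g \<in> carrier (free_group r). cyl r g \<subseteq> U})"
      using openin_bd_topology_cyl[of r U] by auto
    show "U \<in> sigma_sets (boundary r) (long_cyls r)"
      by (subst U) (auto intro!: sigma_sets_UNION countable_subset[OF _ countable_carrier_free_group] cyl)
  next
    fix A assume "A \<in> long_cyls r"
    then have "openin (bd_topology r) A"
      unfolding long_cyls_def bd_topology_def by (auto intro: topology_generated_by_Basis)
    then show "A \<in> sigma_sets (boundary r) {U. openin (bd_topology r) U}"
      by auto
  qed
  then show ?thesis
    using sub by (simp add: bd_borel_def)
qed

section \<open>Explicit densities for letters and words\<close>

definition gen_density :: "nat \<Rightarrow> letter \<Rightarrow> letter stream \<Rightarrow> real" where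
  "gen_density r x \<omega> = (if shd \<omega> = x then real (2 * r - 1) else 1 / real (2 * r - 1))"

text \<open>The chain rule \<open>P(xg, \<omega>) = P(x, \<omega>) P(g, x\<^sup>-\<^sup>1 \<omega>)\<close>, read as a recursion on words.\<close>

primrec word_density :: "nat \<Rightarrow> letter list \<Rightarrow> letter stream \<Rightarrow> real" where
  "word_density r [] \<omega> = 1"
| "word_density r (x # g) \<omega> = gen_density r x \<omega> * word_density r g (scons_red (letter_inv x) \<omega>)"

lemma mem_bd_A_Cons_0:
  "\<omega> \<in> bd_A r 0 (x # g) \<longleftrightarrow> \<omega> \<in> boundary r \<and> shd \<omega> \<noteq> x"
  by (auto simp: bd_A_def)

lemma mem_bd_A_Cons_Suc:
  "\<omega> \<in> bd_A r (Suc i) (x # g) \<longleftrightarrow> \<omega> \<in> boundary r \<and> shd \<omega> = x \<and> stl \<omega> \<in> bd_A r i g"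
  by (auto simp: bd_A_def stl_boundary mem_cyl_Cons)

lemma bd_A_0_Nil: "bd_A r 0 [] = boundary r"
  by (simp add: bd_A_def cyl_Nil)

text \<open>Applying the inverses of the letters of \<open>g\<close> one by one, each of the
  \<open>i\<close> matching letters is stripped from \<open>\<omega>\<close> and contributes a
  factor q. After the first mismatch letters are only prepended, and each of the remaining ones
  contributes 1/q.\<close>

lemma word_density_bd_A:
  assumes "r \<ge> 1" "g \<in> carrier (free_group r)" "i \<le> length g" "\<omega> \<in> bd_A r i g"
  shows "word_density r g \<omega> = real (2 * r - 1) powi (2 * int i - int (length g))"
  using assms(2-4)
proof (induction g arbitrary: i \<omega>)
  case (Cons x g)
  have q: "real (2 * r - 1) \<noteq> 0"
    using assms(1) by simp
  show ?case
  proof (cases i)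
    case 0
    then have \<omega>: "\<omega> \<in> boundary r" "shd \<omega> \<noteq> x"
      using Cons.prems by (auto simp: mem_bd_A_Cons_0)
    \<comment> \<open>A mismatch persists: \<open>x # g\<close> is reduced, so the next letter of
      \<open>g\<close> differs from the \<open>letter_inv x\<close> just prepended.\<close>
    then have "letter_inv x ## \<omega> \<in> bd_A r 0 g"
      using Cons.prems(1)
      by (cases g) (auto simp: bd_A_0_Nil mem_bd_A_Cons_0 Cons_boundary Cons_carrier_free_group)
    then have "word_density r g (letter_inv x ## \<omega>) = real (2 * r - 1) powi (- int (length g))"
      using Cons.IH[of 0] Cons.prems(1) by (simp add: Cons_carrier_free_group)
    moreover have "real (2 * r - 1) powi (2 * int i - int (length (x # g))) =
        inverse (real (2 * r - 1)) * real (2 * r - 1) powi (- int (length g))"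
      using 0 q power_int_add[of "real (2 * r - 1)" "- 1" "- int (length g)"] by simp
    ultimately show ?thesis
      using \<omega>(2) by (simp add: gen_density_def scons_red_def divide_inverse)
  next
    case (Suc j)
    then have \<omega>: "shd \<omega> = x" "stl \<omega> \<in> bd_A r j g"
      using Cons.prems by (auto simp: mem_bd_A_Cons_Suc)
    then have "word_density r g (stl \<omega>) = real (2 * r - 1) powi (2 * int j - int (length g))"
      using Cons.IH[of j] Cons.prems Suc by (simp add: Cons_carrier_free_group)
    moreover have "2 * int i - int (length (x # g)) = 1 + (2 * int j - int (length g))"
      using Suc by simp
    ultimately show ?thesis
      using \<omega>(1) q by (simp add: gen_density_def scons_red_def power_int_add del: of_nat_Suc)
  qed
qed simp

lemma gen_density_nonneg: "gen_density r x \<omega> \<ge> 0"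
  by (simp add: gen_density_def)

lemma word_density_nonneg: "word_density r g \<omega> \<ge> 0"
  by (induction g arbitrary: \<omega>) (simp_all add: gen_density_nonneg)

section \<open>The boundary measure and its Radon-Nikodym derivatives\<close>

locale bd_measure =
  fixes r :: nat and \<nu> :: "letter stream measure"
  assumes rank: "r \<ge> 1" and is_bd_measure: "is_bd_measure r \<nu>"
begin

sublocale prob_space \<nu>
  using is_bd_measure by (simp add: is_bd_measure_def)

lemma sets_\<nu>: "sets \<nu> = sigma_sets (boundary r) (long_cyls r)"
  using is_bd_measure by (simp add: is_bd_measure_def sets_bd_borel)

lemma space_\<nu>: "space \<nu> = boundary r"
  using sets_eq_imp_space_eq[of \<nu> "sigma (boundary r) (long_cyls r)"] sets_\<nu> long_cyls_Pow
  by simp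

lemma sets_cyl [measurable]: "cyl r g \<in> sets \<nu>"
  unfolding sets_\<nu>
  by (subst cyl_eq_UN_long_cyls)
     (auto intro!: sigma_sets_UNION countable_subset[OF _ countable_carrier_free_group]
           simp: long_cyls_def)

lemma emeasure_cyl:
  assumes "g \<in> carrier (free_group r)" "g \<noteq> []"
  shows "emeasure \<nu> (cyl r g) =
           ennreal (1 / ((real (2 * r - 1) + 1) * real (2 * r - 1) ^ (length g - 1)))"
  using is_bd_measure assms by (simp add: is_bd_measure_def one_free_group emeasure_eq_measure)

lemma measurable_scons_red:
  assumes "x \<in> letters r"
  shows "scons_red x \<in> measurable \<nu> \<nu>"
proof -
  have "scons_red x \<in> measurable \<nu> (sigma (boundary r) (long_cyls r))"
  proof (rule measurable_measure_of[OF long_cyls_Pow])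
    show "scons_red x \<in> space \<nu> \<rightarrow> boundary r"
      using assms by (auto simp: space_\<nu> scons_red_boundary)
    fix A assume "A \<in> long_cyls r"
    then consider "A = {}"
      | g where "A = cyl r g" "g \<in> carrier (free_group r)" "length g \<ge> 2"
      by (auto simp: long_cyls_def)
    then show "scons_red x -` A \<inter> space \<nu> \<in> sets \<nu>"
    proof cases
      case 2
      then have "scons_red x -` A \<inter> space \<nu> = cyl r (if hd g = x then tl g else letter_inv x # g)"
        using assms scons_red_mem_cyl[of x r g] cyl_subset_boundary by (force simp: space_\<nu>)
      then show ?thesis by simp
    qed simp
  qed
  then show ?thesis
    by (subst measurable_cong_sets[OF refl, of _ "sigma (boundary r) (long_cyls r)"])
       (simp_all add: sets_\<nu> long_cyls_Pow)
qed

lemma measurable_bd_act: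
  "set g \<subseteq> letters r \<Longrightarrow> bd_act g \<in> measurable \<nu> \<nu>"
proof (induction g)
  case (Cons x g)
  then have "(\<lambda>\<omega>. scons_red x (bd_act g \<omega>)) \<in> measurable \<nu> \<nu>"
    by (intro measurable_compose[OF _ measurable_scons_red]) auto
  then show ?case by (simp add: bd_act_Cons[abs_def])
qed (simp add: bd_act_def)

lemma sets_bd_A [measurable]: "bd_A r i g \<in> sets \<nu>"
proof -
  have "{\<omega> \<in> boundary r. stake i \<omega> = take i g \<and> \<omega> !! i \<noteq> g ! i} = cyl r (take i g) - cyl r (take (Suc i) g)"
    if "i < length g"
    using that by (auto simp: cyl_def stake_Suc take_Suc_conv_app_nth simp del: stake.simps(2))
  then show ?thesis by (simp add: bd_A_def)
qed

lemma gen_density_measurable [measurable]: "gen_density r x \<in> borel_measurable \<nu>"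
proof -
  have "gen_density r x \<omega> = (if \<omega> \<in> cyl r [x] then real (2 * r - 1) else 1 / real (2 * r - 1))"
    if "\<omega> \<in> space \<nu>" for \<omega>
    using that by (auto simp: gen_density_def cyl_def space_\<nu>)
  then show ?thesis by (simp cong: measurable_cong)
qed

lemma word_density_measurable:
  "set g \<subseteq> letters r \<Longrightarrow> word_density r g \<in> borel_measurable \<nu>"
proof (induction g)
  case (Cons x g)
  then have "(\<lambda>\<omega>. word_density r g (scons_red (letter_inv x) \<omega>)) \<in> borel_measurable \<nu>"
    by (intro measurable_compose[OF measurable_scons_red]) auto
  then show ?case by (simp add: word_density.simps[abs_def])
next
  case Nil
  then show ?case by (simp cong: measurable_cong)
qed

text \<open>Both sides are measures agreeing on the intersection-stable generator
  \<open>long_cyls\<close>. The preimage of a long cylinder is a cylinder whose word is one letter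
  shorter or longer, so its measure changes by the factor q or 1/q, which is the value of
  \<open>gen_density\<close> there.\<close>

lemma distr_scons_red:
  assumes x: "x \<in> letters r"
  shows "distr \<nu> \<nu> (scons_red x) = density \<nu> (\<lambda>\<omega>. ennreal (gen_density r x \<omega>))"
proof (rule measure_eqI_generator_eq_countable[OF Int_stable_long_cyls long_cyls_Pow])
  define q where "q = real (2 * r - 1)"
  have q: "q > 0" using rank by (simp add: q_def)
  fix A assume "A \<in> long_cyls r"
  then consider "A = {}"
    | g where "A = cyl r g" "g \<in> carrier (free_group r)" "length g \<ge> 2"
    by (auto simp: long_cyls_def)
  then show "emeasure (distr \<nu> \<nu> (scons_red x)) A
      = emeasure (density \<nu> (\<lambda>\<omega>. ennreal (gen_density r x \<omega>))) A"
  proof cases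
    case 2
    \<comment> \<open>\<open>h\<close> is the word of the preimage cylinder, and \<open>c\<close> is
      the ratio of the two measures.\<close>
    define h where "h = (if hd g = x then tl g else letter_inv x # g)"
    define c where "c = (if hd g = x then q else 1 / q)"
    obtain y z g' where g: "g = y # z # g'"
      using 2(3) by (cases g rule: remdups_adj.cases) auto
    have "scons_red x -` A \<inter> space \<nu> = cyl r h"
      using x 2 scons_red_mem_cyl[of x r g] cyl_subset_boundary by (force simp: space_\<nu> h_def)
    then have "emeasure (distr \<nu> \<nu> (scons_red x)) A = emeasure \<nu> (cyl r h)"
      using 2 by (simp add: emeasure_distr measurable_scons_red x)
    also have "\<dots> = ennreal (1 / ((q + 1) * q ^ (length h - 1)))"
      unfolding q_def using x 2(2) g
      by (intro emeasure_cyl) (auto simp: h_def Cons_carrier_free_group)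
    also have "\<dots> = ennreal c * ennreal (1 / ((q + 1) * q ^ (length g - 1)))"
      using g q by (subst ennreal_mult[symmetric]) (auto simp: h_def c_def)
    also have "\<dots> = ennreal c * emeasure \<nu> (cyl r g)"
      using 2 g by (subst emeasure_cyl) (auto simp: q_def)
    also have "\<dots> = (\<integral>\<^sup>+\<omega>. ennreal c * indicator (cyl r g) \<omega> \<partial>\<nu>)"
      by (simp add: nn_integral_cmult_indicator)
    \<comment> \<open>The density depends on the first letter only, which is \<open>hd g\<close>
      throughout \<open>cyl r g\<close>.\<close>
    also have "\<dots> = (\<integral>\<^sup>+\<omega>. ennreal (gen_density r x \<omega>) * indicator (cyl r g) \<omega> \<partial>\<nu>)"
      using g by (intro nn_integral_cong)
        (auto simp: c_def gen_density_def q_def mem_cyl_Cons split: split_indicator)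
    also have "\<dots> = emeasure (density \<nu> (\<lambda>\<omega>. ennreal (gen_density r x \<omega>))) A"
      using 2 by (simp add: emeasure_density)
    finally show ?thesis .
  qed simp
next
  show "\<Union> (long_cyls r) = boundary r"
    using cyl_eq_UN_long_cyls[of r "[]"] long_cyls_Pow[of r] by (auto simp: cyl_Nil long_cyls_def)
  show "countable (long_cyls r)"
    unfolding long_cyls_def
    by (auto intro: countable_subset[OF _ countable_carrier_free_group])
  show "emeasure (distr \<nu> \<nu> (scons_red x)) A \<noteq> \<infinity>" for A
  proof -
    interpret D: prob_space "distr \<nu> \<nu> (scons_red x)"
      by (rule prob_space_distr[OF measurable_scons_red[OF x]])
    show ?thesis by simp
  qed
qed (auto simp: sets_\<nu>)

lemma distr_bd_act:
  assumes "set g \<subseteq> letters r"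
  shows "distr \<nu> \<nu> (bd_act g) = density \<nu> (\<lambda>\<omega>. ennreal (word_density r g \<omega>))"
  using assms
proof (induction g)
  case Nil
  then show ?case by (simp add: bd_act_def id_def distr_id2 density_1)
next
  case (Cons x g)
  let ?f = "\<lambda>\<omega>. ennreal (word_density r g (scons_red (letter_inv x) \<omega>))"
  have x: "x \<in> letters r" and g: "set g \<subseteq> letters r"
    using Cons.prems by auto
  have f: "?f \<in> borel_measurable \<nu>"
    using x g
    by (intro measurable_compose[OF measurable_compose[OF measurable_scons_red word_density_measurable]
          measurable_ennreal]) auto
  note [measurable] = measurable_bd_act[OF g] measurable_scons_red[OF x] word_density_measurable[OF g]
  have "distr \<nu> \<nu> (bd_act (x # g)) = distr (distr \<nu> \<nu> (bd_act g)) \<nu> (scons_red x)"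
    by (simp add: distr_distr[OF measurable_scons_red[OF x] measurable_bd_act[OF g]]
          comp_def bd_act_Cons[abs_def])
  \<comment> \<open>Writing the density of the inner push-forward as a function of
    \<open>scons_red x \<omega>\<close> lets it be pulled out of the outer push-forward.\<close>
  also have "\<dots> = distr (density \<nu> (\<lambda>\<omega>. ?f (scons_red x \<omega>))) \<nu> (scons_red x)"
    unfolding Cons.IH[OF g] using measurable_compose[OF measurable_scons_red[OF x] f]
    by (intro distr_cong density_cong arg_cong[where f = "\<lambda>M. distr M \<nu> _"])
       (auto simp: scons_red_inverse space_\<nu>)
  also have "\<dots> = density (density \<nu> (\<lambda>\<omega>. ennreal (gen_density r x \<omega>))) ?f"
    unfolding distr_scons_red[OF x, symmetric]
    by (rule density_distr[OF f measurable_scons_red[OF x], symmetric])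
  also have "\<dots> = density \<nu> (\<lambda>\<omega>. ennreal (word_density r (x # g) \<omega>))"
    using f by (simp add: density_density_eq ennreal_mult' gen_density_nonneg)
  finally show ?case .
qed

text \<open>By uniqueness of the Radon-Nikodym derivative, the arbitrary version in
  \<open>bd_P\<close> may be replaced by the explicit formula off a null set.\<close>

lemma AE_bd_P:
  assumes "set g \<subseteq> letters r"
  shows "AE \<omega> in \<nu>. bd_P \<nu> g \<omega> = word_density r g \<omega>"
proof -
  have "AE \<omega> in \<nu>. ennreal (word_density r g \<omega>) = RN_deriv \<nu> (distr \<nu> \<nu> (bd_act g)) \<omega>"
    using word_density_measurable[OF assms] distr_bd_act[OF assms]
    by (intro RN_deriv_unique) auto
  then show ?thesis
    by eventually_elim (metis bd_P_def enn2real_ennreal word_density_nonneg)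
qed

end

section \<open>How the action moves the sets A_i(g)\<close>

lemma mem_bd_A_iff:
  assumes "i \<le> length g"
  shows "\<omega> \<in> bd_A r i g \<longleftrightarrow>
    \<omega> \<in> boundary r \<and> stake i \<omega> = take i g \<and> (i < length g \<longrightarrow> \<omega> !! i \<noteq> g ! i)"
  using assms by (auto simp: bd_A_def cyl_def)

lemma bd_act_inv_shift: "bd_act (rev (map letter_inv u)) (u @- \<omega>) = \<omega>"
  by (induction u) (simp_all add: bd_act_Nil bd_act_append bd_act_Cons scons_red_def)

lemma shift_boundary:
  "w @- \<omega> \<in> boundary r \<longleftrightarrow>
    w \<in> carrier (free_group r) \<and> \<omega> \<in> boundary r \<and> (w \<noteq> [] \<longrightarrow> shd \<omega> \<noteq> letter_inv (last w))"
proof (induction w)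
  case (Cons x w)
  then show ?case
    by (cases w) (auto simp: Cons_boundary Cons_carrier_free_group mem_carrier_free_group)
qed (simp add: mem_carrier_free_group)

lemma bd_act_reduced:
  "w @- \<omega> \<in> boundary r \<Longrightarrow> bd_act w \<omega> = w @- \<omega>"
  by (induction w) (auto simp: bd_act_Nil bd_act_Cons Cons_boundary scons_red_def)

lemma take_carrier_free_group:
  "g \<in> carrier (free_group r) \<Longrightarrow> take k g \<in> carrier (free_group r)"
  using set_take_subset[of k g] by (auto simp: mem_carrier_free_group reduced_word_def)

text \<open>With \<open>u = take i g\<close> and \<open>v\<close> the inverse of
  \<open>drop i g\<close>, the inverse of \<open>g\<close> is \<open>v\<close> followed by the
  inverse of \<open>u\<close>. Writing \<open>\<omega> = u @- s\<close>, the action removes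
  \<open>u\<close> and puts \<open>v\<close> in front of \<open>s\<close>. Nothing cancels in
  \<open>v @- s\<close> because \<open>\<omega>\<close> departs from \<open>g\<close> after
  \<open>i\<close> letters. Agreement with the inverse of \<open>g\<close> ends after
  \<open>v\<close> because \<open>u @- s\<close> is reduced.\<close>

lemma bd_act_inv_bd_A:
  assumes g: "g \<in> carrier (free_group r)" and i: "i \<le> length g" and \<omega>: "\<omega> \<in> bd_A r i g"
  shows "bd_act (inv\<^bsub>free_group r\<^esub> g) \<omega> \<in> bd_A r (length g - i) (inv\<^bsub>free_group r\<^esub> g)"
proof -
  define u v s where "u = take i g" and "v = rev (map letter_inv (drop i g))" and "s = sdrop i \<omega>"
  have inv: "inv\<^bsub>free_group r\<^esub> g = v @ rev (map letter_inv u)"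
    using g append_take_drop_id[of i g]
    by (simp add: inv_free_group u_def v_def flip: rev_append map_append)
  have \<omega>': "\<omega> \<in> boundary r" "stake i \<omega> = u" "i < length g \<Longrightarrow> \<omega> !! i \<noteq> g ! i"
    using \<omega> i by (auto simp: mem_bd_A_iff u_def)
  have us: "\<omega> = u @- s"
    using \<omega>'(2) stake_sdrop[of i \<omega>] by (simp add: s_def)
  have "v @ rev (map letter_inv u) \<in> carrier (free_group r)"
    using rev_inv_carrier[OF g] g by (simp add: inv flip: inv_free_group)
  then have v: "v \<in> carrier (free_group r)"
    using take_carrier_free_group[of _ r "length v"] by fastforce
  have "letter_inv (last v) = g ! i" if "v \<noteq> []"
    using that i by (auto simp: v_def last_rev hd_map hd_drop_conv_nth)
  then have vs: "v @- s \<in> boundary r"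
    using v \<omega>' i sdrop_boundary[of \<omega> r i] by (auto simp: shift_boundary s_def v_def)
  have act: "bd_act (inv\<^bsub>free_group r\<^esub> g) \<omega> = v @- s"
    by (simp add: inv us bd_act_append bd_act_inv_shift bd_act_reduced[OF vs])
  have len: "length v = length g - i" "length (rev (map letter_inv u)) = i"
    using i by (simp_all add: v_def u_def)
  \<comment> \<open>If \<open>u\<close> is empty then \<open>v\<close> is the whole inverse, and the
    target set is a cylinder without a mismatch condition.\<close>
  have tail: "(v @- s) !! (length g - i) \<noteq> (v @ rev (map letter_inv u)) ! (length g - i)" if "u \<noteq> []"
  proof -
    have "shd s \<noteq> letter_inv (last u)"
      using \<omega>'(1) that unfolding us shift_boundary by simp
    moreover have "rev (map letter_inv u) ! 0 = letter_inv (last u)"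
      using that by (simp add: rev_nth last_conv_nth)
    ultimately show ?thesis
      by (simp add: nth_append flip: len(1))
  qed
  have "stake (length g - i) (v @- s) = v"
    by (simp add: stake_shift flip: len(1))
  then have "v @- s \<in> bd_A r (length g - i) (v @ rev (map letter_inv u))"
    using vs len tail by (subst mem_bd_A_iff) auto
  then show ?thesis
    unfolding act by (simp only: inv)
qed

lemma bd_A_pair_unique:
  assumes "g \<in> sphere_fg r n" "h \<in> sphere_fg r n" "i \<le> n"
    and "\<omega> \<in> bd_A r i g" "\<omega> \<in> bd_A r i h"
    and "\<omega>' \<in> bd_A r (n - i) (inv\<^bsub>free_group r\<^esub> g)" "\<omega>' \<in> bd_A r (n - i) (inv\<^bsub>free_group r\<^esub> h)"
  shows "g = h"
proof -
  have drop: "stake (n - i) \<omega>' = rev (map letter_inv (drop i k))"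
    if "k \<in> sphere_fg r n" "\<omega>' \<in> bd_A r (n - i) (inv\<^bsub>free_group r\<^esub> k)" for k
  proof -
    have k: "k \<in> carrier (free_group r)" "length k = n"
      using that by (auto simp: sphere_fg_def)
    then have "stake (n - i) \<omega>' = take (n - i) (inv\<^bsub>free_group r\<^esub> k)"
      using that(2) by (subst (asm) mem_bd_A_iff) (auto simp: length_inv_free_group)
    also have "\<dots> = rev (map letter_inv (drop i k))"
      using k assms(3) by (simp add: inv_free_group take_rev drop_map)
    finally show ?thesis .
  qed
  have "inj letter_inv"
    by (rule injI) (metis letter_inv_letter_inv)
  then have "drop i g = drop i h"
    using drop[OF assms(1,6)] drop[OF assms(2,7)] by (simp add: inj_map_eq_map)
  moreover have "take i g = take i h"
    using assms(1-5) by (simp add: mem_bd_A_iff sphere_fg_def)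
  ultimately have "take i g @ drop i g = take i h @ drop i h"
    by simp
  then show ?thesis
    by simp
qed

text \<open>The semiring is left general because \<open>T_op_sum_cases\<close> uses the lemma for
  complex values and for values in \<open>ennreal\<close>.\<close>

lemma sum_indicator_unique:
  fixes f :: "'a \<Rightarrow> 'b::semiring_1"
  assumes "finite S" "g \<in> S" "z \<in> D g" "\<And>h. h \<in> S \<Longrightarrow> z \<in> D h \<Longrightarrow> h = g"
  shows "(\<Sum>h\<in>S. indicator (D h) z * f h) = f g"
proof -
  have "(\<Sum>h\<in>S. indicator (D h) z * f h) = (\<Sum>h\<in>S. if g = h then f h else 0)"
  proof (rule sum.cong)
    fix h assume "h \<in> S"
    then show "indicator (D h) z * f h = (if g = h then f h else 0)"
      using assms(3) assms(4)[of h] by (cases "z \<in> D h") auto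
  qed simp
  also have "\<dots> = f g"
    using assms(1,2) by simp
  finally show ?thesis .
qed

section \<open>The product space and the maps acting on it\<close>

context bd_measure
begin

abbreviation \<mu> :: "(letter stream \<times> letter stream) measure" where
  "\<mu> \<equiv> \<nu> \<Otimes>\<^sub>M \<nu>"

sublocale P: pair_prob_space \<nu> \<nu> ..

definition pair_act :: "letter list \<Rightarrow> letter stream \<times> letter stream \<Rightarrow> letter stream \<times> letter stream"
  where "pair_act g = (\<lambda>(\<omega>, \<omega>'). (bd_act (inv\<^bsub>free_group r\<^esub> g) \<omega>, bd_act g \<omega>'))"

definition pair_A :: "nat \<Rightarrow> nat \<Rightarrow> letter list \<Rightarrow> (letter stream \<times> letter stream) set"
  where "pair_A n i g = bd_A r i g \<times> bd_A r (n - i) (inv\<^bsub>free_group r\<^esub> g)"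

text \<open>This is \<open>pair_A n i g\<close> with the coordinates exchanged; it serves as the
  target of \<open>pair_act g\<close> on \<open>pair_A n i g\<close>.\<close>

definition pair_A' :: "nat \<Rightarrow> nat \<Rightarrow> letter list \<Rightarrow> (letter stream \<times> letter stream) set"
  where "pair_A' n i g = bd_A r (n - i) (inv\<^bsub>free_group r\<^esub> g) \<times> bd_A r i g"

lemma sphereD:
  assumes "g \<in> sphere_fg r n"
  shows "g \<in> carrier (free_group r)" "inv\<^bsub>free_group r\<^esub> g \<in> carrier (free_group r)"
    "length g = n" "length (inv\<^bsub>free_group r\<^esub> g) = n"
    "set g \<subseteq> letters r" "set (inv\<^bsub>free_group r\<^esub> g) \<subseteq> letters r"
    "inv\<^bsub>free_group r\<^esub> (inv\<^bsub>free_group r\<^esub> g) = g"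
  using assms group.inv_inv[OF group_free_group, of g r]
    group.inv_closed[OF group_free_group, of g r]
  by (auto simp: sphere_fg_def length_inv_free_group mem_carrier_free_group)

lemma sets_pair_A [measurable]: "pair_A n i g \<in> sets \<mu>" "pair_A' n i g \<in> sets \<mu>"
  by (auto simp: pair_A_def pair_A'_def)

lemma measurable_pair_act:
  "g \<in> sphere_fg r n \<Longrightarrow> pair_act g \<in> measurable \<mu> \<mu>"
  using measurable_bd_act[OF sphereD(5)[of g n]] measurable_bd_act[OF sphereD(6)[of g n]]
  unfolding pair_act_def by measurable

lemma pair_act_pair_A:
  assumes "g \<in> sphere_fg r n" "i \<le> n" "z \<in> pair_A n i g"
  shows "pair_act g z \<in> pair_A' n i g"
  using assms bd_act_inv_bd_A[of g r i "fst z"]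
    bd_act_inv_bd_A[of "inv\<^bsub>free_group r\<^esub> g" r "n - i" "snd z"]
  by (auto simp: pair_A_def pair_A'_def pair_act_def sphereD)

lemma pair_A_unique:
  assumes "i \<le> n" "g \<in> sphere_fg r n" "h \<in> sphere_fg r n"
  shows "z \<in> pair_A n i g \<Longrightarrow> z \<in> pair_A n i h \<Longrightarrow> h = g"
    and "z \<in> pair_A' n i g \<Longrightarrow> z \<in> pair_A' n i h \<Longrightarrow> h = g"
  using assms bd_A_pair_unique[of g r n h i] by (auto simp: pair_A_def pair_A'_def)

text \<open>The exponents of q are 2i - n and 2(n - i) - n, which are opposite.\<close>

lemma word_density_inv:
  assumes "g \<in> sphere_fg r n" "i \<le> n" "\<omega> \<in> bd_A r i g" "\<omega>' \<in> bd_A r (n - i) (inv\<^bsub>free_group r\<^esub> g)"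
  shows "word_density r g \<omega> * word_density r (inv\<^bsub>free_group r\<^esub> g) \<omega>' = 1"
proof -
  have "word_density r g \<omega> = real (2 * r - 1) powi (2 * int i - int n)"
    using word_density_bd_A[of r g i \<omega>] rank assms by (simp add: sphereD)
  moreover have "word_density r (inv\<^bsub>free_group r\<^esub> g) \<omega>' = real (2 * r - 1) powi (- (2 * int i - int n))"
    using word_density_bd_A[of r "inv\<^bsub>free_group r\<^esub> g" "n - i" \<omega>'] rank assms
    by (simp add: sphereD of_nat_diff algebra_simps)
  ultimately show ?thesis
    using rank power_int_add[of "real (2 * r - 1)" "2 * int i - int n" "- (2 * int i - int n)"]
    by simp
qed

lemma distr_pair_act:
  assumes g: "g \<in> sphere_fg r n"
  shows "distr \<mu> \<mu> (pair_act g) =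
    density \<mu> (\<lambda>(\<omega>, \<omega>'). ennreal (word_density r (inv\<^bsub>free_group r\<^esub> g) \<omega>) * ennreal (word_density r g \<omega>'))"
proof -
  note m = measurable_bd_act[OF sphereD(5)[OF g]] measurable_bd_act[OF sphereD(6)[OF g]]
  have sf: "sigma_finite_measure (distr \<nu> \<nu> (bd_act g))"
    using prob_space_distr[OF m(1)] prob_space_imp_sigma_finite by blast
  have "distr \<mu> \<mu> (pair_act g) = distr \<nu> \<nu> (bd_act (inv\<^bsub>free_group r\<^esub> g)) \<Otimes>\<^sub>M distr \<nu> \<nu> (bd_act g)"
    unfolding pair_act_def by (rule pair_measure_distr[OF m(2,1) sf, symmetric])
  also have "\<dots> = density \<nu> (\<lambda>\<omega>. ennreal (word_density r (inv\<^bsub>free_group r\<^esub> g) \<omega>))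
      \<Otimes>\<^sub>M density \<nu> (\<lambda>\<omega>. ennreal (word_density r g \<omega>))"
    by (simp add: distr_bd_act sphereD[OF g])
  also have "\<dots> = density \<mu> (\<lambda>(\<omega>, \<omega>').
      ennreal (word_density r (inv\<^bsub>free_group r\<^esub> g) \<omega>) * ennreal (word_density r g \<omega>'))"
    using sf word_density_measurable sphereD(5,6)[OF g]
    by (intro pair_measure_density) (auto simp: distr_bd_act sphereD[OF g] sigma_finite_measure_axioms)
  finally show ?thesis .
qed

lemma pair_density_measurable:
  assumes g: "g \<in> sphere_fg r n"
  shows "(\<lambda>(\<omega>, \<omega>'). ennreal (word_density r (inv\<^bsub>free_group r\<^esub> g) \<omega>) * ennreal (word_density r g \<omega>'))
    \<in> borel_measurable \<mu>"
  using word_density_measurable[OF sphereD(5)[OF g]] word_density_measurable[OF sphereD(6)[OF g]]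
  by measurable

text \<open>The push-forward has a density, so preimages of null sets are null. This makes
  composition with \<open>pair_act g\<close> well defined on classes and preserves essential
  bounds.\<close>

lemma AE_pair_act:
  assumes g: "g \<in> sphere_fg r n" and P: "AE z in \<mu>. P z"
  shows "AE z in \<mu>. P (pair_act g z)"
proof -
  have "AE z in distr \<mu> \<mu> (pair_act g). P z"
    unfolding distr_pair_act[OF g] AE_density[OF pair_density_measurable[OF g]]
    using P by eventually_elim auto
  then show ?thesis
    by (rule AE_distrD[OF measurable_pair_act[OF g]])
qed

text \<open>Enlarging \<open>pair_A n i g\<close> to the preimage of \<open>pair_A' n i g\<close>
  turns the left side into an integral against the push-forward.\<close>

lemma nn_integral_pair_act_le:
  assumes g: "g \<in> sphere_fg r n" and i: "i \<le> n" and h [measurable]: "h \<in> borel_measurable \<mu>"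
  shows "(\<integral>\<^sup>+z. indicator (pair_A n i g) z * h (pair_act g z) \<partial>\<mu>)
    \<le> (\<integral>\<^sup>+z. indicator (pair_A' n i g) z * h z \<partial>\<mu>)"
proof -
  have "(\<integral>\<^sup>+z. indicator (pair_A n i g) z * h (pair_act g z) \<partial>\<mu>)
      \<le> (\<integral>\<^sup>+z. indicator (pair_A' n i g) (pair_act g z) * h (pair_act g z) \<partial>\<mu>)"
    using pair_act_pair_A[OF g i] by (intro nn_integral_mono) (auto split: split_indicator)
  also have "\<dots> = (\<integral>\<^sup>+z. indicator (pair_A' n i g) z * h z \<partial>distr \<mu> \<mu> (pair_act g))"
    by (rule nn_integral_distr[OF measurable_pair_act[OF g], symmetric]) simp
  also have "\<dots> = (\<integral>\<^sup>+z. (case z of (\<omega>, \<omega>') \<Rightarrow>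
        ennreal (word_density r (inv\<^bsub>free_group r\<^esub> g) \<omega>) * ennreal (word_density r g \<omega>'))
      * (indicator (pair_A' n i g) z * h z) \<partial>\<mu>)"
    unfolding distr_pair_act[OF g]
    by (rule nn_integral_density[OF pair_density_measurable[OF g]]) simp
  \<comment> \<open>On \<open>pair_A' n i g\<close> the density is 1, by
    \<open>word_density_inv\<close> with the coordinates exchanged.\<close>
  also have "\<dots> = (\<integral>\<^sup>+z. indicator (pair_A' n i g) z * h z \<partial>\<mu>)"
    using word_density_inv[OF g i]
    by (intro nn_integral_cong)
       (auto simp: pair_A'_def mult.commute word_density_nonneg ennreal_mult[symmetric]
             split: split_indicator)
  finally show ?thesis .
qed

section \<open>The operator as a sum of restricted compositions\<close>

lemma measurable_bd_P [measurable]: "bd_P \<nu> g \<in> borel_measurable \<nu>"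
  unfolding bd_P_def[abs_def] by measurable

lemma AE_sqrt_bd_P:
  assumes i: "i \<le> n"
  shows "AE z in \<mu>. \<forall>g\<in>sphere_fg r n. z \<in> pair_A n i g \<longrightarrow>
    sqrt (bd_P \<nu> g (fst z)) * sqrt (bd_P \<nu> (inv\<^bsub>free_group r\<^esub> g) (snd z)) = 1"
proof (rule AE_ball_countable[THEN iffD2, rule_format])
  fix g assume g: "g \<in> sphere_fg r n"
  let ?g' = "inv\<^bsub>free_group r\<^esub> g"
  note [measurable] = word_density_measurable[OF sphereD(5)[OF g]] word_density_measurable[OF sphereD(6)[OF g]]
  have "AE z in \<mu>. bd_P \<nu> g (fst z) = word_density r g (fst z)"
    using AE_bd_P[OF sphereD(5)[OF g]] by (intro P.AE_pair_measure) simp_all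
  moreover have "AE z in \<mu>. bd_P \<nu> ?g' (snd z) = word_density r ?g' (snd z)"
    using AE_bd_P[OF sphereD(6)[OF g]] by (intro P.AE_pair_measure) simp_all
  ultimately show "AE z in \<mu>. z \<in> pair_A n i g \<longrightarrow>
      sqrt (bd_P \<nu> g (fst z)) * sqrt (bd_P \<nu> ?g' (snd z)) = 1"
    by eventually_elim
       (auto simp: pair_A_def word_density_inv[OF g i] simp flip: real_sqrt_mult)
qed (simp add: countable_finite finite_sphere_fg)

text \<open>\<open>F\<close> is quantified inside the almost-everywhere statement: the exceptional
  set comes from the derivatives alone, so one null set serves all functions.\<close>

lemma AE_T_op:
  assumes i: "i \<le> n"
  shows "AE z in \<mu>. \<forall>F. T_op r \<nu> n i F z =
    (\<Sum>g\<in>sphere_fg r n. indicator (pair_A n i g) z * F (pair_act g z))"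
  using AE_sqrt_bd_P[OF i]
proof eventually_elim
  case (elim z)
  show ?case
  proof
    fix F :: "letter stream \<times> letter stream \<Rightarrow> complex"
    have "indicator (bd_A r i g) (fst z) * indicator (bd_A r (n - i) (inv\<^bsub>free_group r\<^esub> g)) (snd z)
        * of_real (sqrt (bd_P \<nu> g (fst z))) * of_real (sqrt (bd_P \<nu> (inv\<^bsub>free_group r\<^esub> g) (snd z)))
        * F (bd_act (inv\<^bsub>free_group r\<^esub> g) (fst z), bd_act g (snd z))
      = indicator (pair_A n i g) z * F (pair_act g z)" if g: "g \<in> sphere_fg r n" for g
    proof (cases "z \<in> pair_A n i g")
      case True
      then have "of_real (sqrt (bd_P \<nu> g (fst z))) *
          of_real (sqrt (bd_P \<nu> (inv\<^bsub>free_group r\<^esub> g) (snd z))) = (1::complex)"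
        using elim g by (metis of_real_1 of_real_mult)
      then show ?thesis
        using True by (auto simp: pair_A_def pair_act_def)
    next
      case False
      then show ?thesis
        by (auto simp: pair_A_def mem_Times_iff split: split_indicator)
    qed
    then show "T_op r \<nu> n i F z =
        (\<Sum>g\<in>sphere_fg r n. indicator (pair_A n i g) z * F (pair_act g z))"
      by (simp add: T_op_def case_prod_beta)
  qed
qed

section \<open>Measurability and L^p bounds of the operator\<close>

lemma measurable_T_op:
  assumes F [measurable]: "F \<in> borel_measurable \<mu>"
  shows "T_op r \<nu> n i F \<in> borel_measurable \<mu>"
  unfolding T_op_def case_prod_beta
proof (rule borel_measurable_sum)
  fix g assume g: "g \<in> sphere_fg r n"
  have [measurable]: "(\<lambda>z. F (bd_act (inv\<^bsub>free_group r\<^esub> g) (fst z), bd_act g (snd z))) \<in> borel_measurable \<mu>"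
    using measurable_compose[OF measurable_pair_act[OF g] F] by (simp add: pair_act_def case_prod_beta)
  show "(\<lambda>z. indicator (bd_A r i g) (fst z) * indicator (bd_A r (n - i) (inv\<^bsub>free_group r\<^esub> g)) (snd z)
        * of_real (sqrt (bd_P \<nu> g (fst z))) * of_real (sqrt (bd_P \<nu> (inv\<^bsub>free_group r\<^esub> g) (snd z)))
        * F (bd_act (inv\<^bsub>free_group r\<^esub> g) (fst z), bd_act g (snd z))) \<in> borel_measurable \<mu>"
    by measurable
qed

text \<open>At most one term survives at each point, so norms and powers pass through the sum. The
  same \<open>g\<close> has to serve the complex sum for \<open>T_op\<close> and the
  \<open>ennreal\<close> sum that bounds its power.\<close>

lemma T_op_sum_cases:
  assumes "i \<le> n"
  obtains "\<And>g. g \<in> sphere_fg r n \<Longrightarrow> z \<notin> pair_A n i g"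
  | g where "g \<in> sphere_fg r n" "z \<in> pair_A n i g"
      "\<And>f :: letter list \<Rightarrow> complex. (\<Sum>h\<in>sphere_fg r n. indicator (pair_A n i h) z * f h) = f g"
      "\<And>f :: letter list \<Rightarrow> ennreal. (\<Sum>h\<in>sphere_fg r n. indicator (pair_A n i h) z * f h) = f g"
proof (cases "\<exists>g\<in>sphere_fg r n. z \<in> pair_A n i g")
  case True
  then obtain g where g: "g \<in> sphere_fg r n" "z \<in> pair_A n i g" by blast
  show ?thesis
    using pair_A_unique(1)[OF assms g(1)] g
    by (intro that(2)[OF g]; intro sum_indicator_unique finite_sphere_fg) auto
qed (use that in blast)

lemma nn_integral_T_op_le:
  assumes i: "i \<le> n" and p: "p > 0" and F [measurable]: "F \<in> borel_measurable \<mu>"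
  shows "(\<integral>\<^sup>+z. ennreal (norm (T_op r \<nu> n i F z) powr p) \<partial>\<mu>) \<le> (\<integral>\<^sup>+z. ennreal (norm (F z) powr p) \<partial>\<mu>)"
proof -
  define H where "H z = ennreal (norm (F z) powr p)" for z
  have [measurable]: "H \<in> borel_measurable \<mu>"
    unfolding H_def[abs_def] by measurable
  have [measurable]: "(\<lambda>z. H (pair_act g z)) \<in> borel_measurable \<mu>" if "g \<in> sphere_fg r n" for g
    by (rule measurable_compose[OF measurable_pair_act[OF that]]) measurable
  have "(\<integral>\<^sup>+z. ennreal (norm (T_op r \<nu> n i F z) powr p) \<partial>\<mu>)
      \<le> (\<integral>\<^sup>+z. (\<Sum>g\<in>sphere_fg r n. indicator (pair_A n i g) z * H (pair_act g z)) \<partial>\<mu>)"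
  proof (rule nn_integral_mono_AE)
    show "AE z in \<mu>. ennreal (norm (T_op r \<nu> n i F z) powr p)
        \<le> (\<Sum>g\<in>sphere_fg r n. indicator (pair_A n i g) z * H (pair_act g z))"
      using AE_T_op[OF i]
    proof eventually_elim
      case (elim z)
      show ?case
        by (rule T_op_sum_cases[OF i, of z]) (simp_all add: elim H_def)
    qed
  qed
  also have "\<dots> = (\<Sum>g\<in>sphere_fg r n. \<integral>\<^sup>+z. indicator (pair_A n i g) z * H (pair_act g z) \<partial>\<mu>)"
    by (rule nn_integral_sum) measurable
  also have "\<dots> \<le> (\<Sum>g\<in>sphere_fg r n. \<integral>\<^sup>+z. indicator (pair_A' n i g) z * H z \<partial>\<mu>)"
    using i by (intro sum_mono nn_integral_pair_act_le) auto
  also have "\<dots> = (\<integral>\<^sup>+z. (\<Sum>g\<in>sphere_fg r n. indicator (pair_A' n i g) z * H z) \<partial>\<mu>)"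
    by (rule nn_integral_sum[symmetric]) measurable
  also have "\<dots> \<le> (\<integral>\<^sup>+z. H z \<partial>\<mu>)"
  proof (rule nn_integral_mono)
    fix z
    \<comment> \<open>The targets are disjoint for distinct \<open>g\<close>, so \<open>H z\<close>
      is counted at most once.\<close>
    show "(\<Sum>g\<in>sphere_fg r n. indicator (pair_A' n i g) z * H z) \<le> H z"
    proof (cases "\<exists>g\<in>sphere_fg r n. z \<in> pair_A' n i g")
      case True
      then obtain g where g: "g \<in> sphere_fg r n" "z \<in> pair_A' n i g" by blast
      have "(\<Sum>g\<in>sphere_fg r n. indicator (pair_A' n i g) z * H z) = H z"
        using pair_A_unique(2)[OF i g(1)] g
        by (intro sum_indicator_unique[where f = "\<lambda>_. H z" and g = g] finite_sphere_fg) auto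
      then show ?thesis by simp
    qed simp
  qed
  finally show ?thesis by (simp add: H_def)
qed

lemma Lp_norm_T_op_le:
  assumes i: "i \<le> n" and p: "1 \<le> p" and F [measurable]: "F \<in> borel_measurable \<mu>"
  shows "Lp_norm p \<mu> (T_op r \<nu> n i F) \<le> Lp_norm p \<mu> F"
proof (cases "p = \<infinity>")
  case True
  note [measurable] = measurable_T_op[OF F]
  \<comment> \<open>The essential bound survives each composition, and the sphere is finite, so a
    single null set suffices.\<close>
  have "AE z in \<mu>. \<forall>g\<in>sphere_fg r n. ennreal (norm (F (pair_act g z))) \<le> esssup \<mu> (\<lambda>z. ennreal (norm (F z)))"
    by (subst AE_ball_countable)
       (auto intro: AE_pair_act[OF _ esssup_AE] simp: countable_finite finite_sphere_fg)
  then have "AE z in \<mu>. ennreal (norm (T_op r \<nu> n i F z)) \<le> esssup \<mu> (\<lambda>z. ennreal (norm (F z)))"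
    using AE_T_op[OF i]
  proof eventually_elim
    case (elim z)
    show ?case
      by (rule T_op_sum_cases[OF i, of z]) (use elim in auto)
  qed
  then have "esssup \<mu> (\<lambda>z. ennreal (norm (T_op r \<nu> n i F z))) \<le> esssup \<mu> (\<lambda>z. ennreal (norm (F z)))"
    by (intro esssup_I) auto
  then show ?thesis
    using True by (simp add: Lp_norm_def)
next
  case False
  define I J where "I = (\<integral>\<^sup>+z. ennreal (norm (T_op r \<nu> n i F z) powr enn2real p) \<partial>\<mu>)"
    and "J = (\<integral>\<^sup>+z. ennreal (norm (F z) powr enn2real p) \<partial>\<mu>)"
  have "enn2real p > 0"
    using p False by (cases p) auto
  then have "I \<le> J"
    unfolding I_def J_def by (intro nn_integral_T_op_le i F)
  \<comment> \<open>\<open>enn2real\<close> sends infinity to 0, so it is monotone only below a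
    finite bound. For infinite \<open>J\<close> the norm of \<open>F\<close> is infinite and the
    claim is trivial.\<close>
  moreover have "ennreal (enn2real I powr (1 / enn2real p)) \<le> ennreal (enn2real J powr (1 / enn2real p))"
    if "J < \<top>"
    using that \<open>I \<le> J\<close> by (intro ennreal_leI powr_mono2 enn2real_mono) auto
  ultimately show ?thesis
    using False by (auto simp: Lp_norm_def Let_def top_unique less_top simp flip: I_def J_def)
qed

lemma Lp_operator_T_op:
  assumes i: "i \<le> n" and p: "1 \<le> p"
  shows "Lp_operator p \<mu> (T_op r \<nu> n i)"
  unfolding Lp_operator_def
proof (intro conjI ballI impI allI)
  fix F assume F: "F \<in> Lp_set p \<mu>"
  then show "T_op r \<nu> n i F \<in> Lp_set p \<mu>"
    using Lp_norm_T_op_le[OF i p, of F] measurable_T_op[of F n i] by (auto simp: Lp_set_def)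
  fix c
  \<comment> \<open>Homogeneity, like additivity below, holds at every point; only compatibility
    with almost-everywhere equality involves null sets.\<close>
  show "AE z in \<mu>. T_op r \<nu> n i (\<lambda>y. c * F y) z = c * T_op r \<nu> n i F z"
    by (simp add: T_op_def case_prod_beta sum_distrib_left mult_ac)
next
  fix F G
  show "AE z in \<mu>. T_op r \<nu> n i (\<lambda>y. F y + G y) z = T_op r \<nu> n i F z + T_op r \<nu> n i G z"
    by (simp add: T_op_def case_prod_beta sum.distrib distrib_left)
  assume FG: "AE z in \<mu>. F z = G z"
  have "AE z in \<mu>. \<forall>g\<in>sphere_fg r n. F (pair_act g z) = G (pair_act g z)"
    using AE_pair_act[OF _ FG]
    by (subst AE_ball_countable) (simp_all add: countable_finite finite_sphere_fg)
  with AE_T_op[OF i] show "AE z in \<mu>. T_op r \<nu> n i F z = T_op r \<nu> n i G z"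
    by eventually_elim (auto intro: sum.cong)
qed

lemma Lp_opnorm_T_op_le:
  assumes i: "i \<le> n" and p: "1 \<le> p"
  shows "Lp_opnorm p \<mu> (T_op r \<nu> n i) \<le> 1"
  unfolding Lp_opnorm_def
  using Lp_norm_T_op_le[OF i p] by (intro SUP_least) (auto simp: Lp_set_def intro: order_trans)

end

theorem mainTheorem2:
  fixes r n i :: nat and p :: ennreal and \<nu> :: "letter stream measure"
  assumes "r \<ge> 1" and "is_bd_measure r \<nu>" and "i \<le> n" and "1 \<le> p"
  shows "Lp_operator p (\<nu> \<Otimes>\<^sub>M \<nu>) (T_op r \<nu> n i)
       \<and> Lp_opnorm p (\<nu> \<Otimes>\<^sub>M \<nu>) (T_op r \<nu> n i) \<le> 1"
proof -
  interpret bd_measure r \<nu>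
    using assms(1,2) by unfold_locales
  show ?thesis
    using Lp_operator_T_op Lp_opnorm_T_op_le assms(3,4) by blast
qed

end
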